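(* Let $G$ be a discrete, countable abelian group and let $\pi: G \to B(H)$, $g \mapsto \pi_g$, be a unitary representation of $G$ on a Hilbert space $H$. Suppose that $\pi$ admits a finite complete wandering frame collection $W$. Suppose that $Y \subset H$ is a wandering frame collection for $\pi$ (so that $\{\pi_g y : g \in G,\ y \in Y\}$ is a frame for its closed linear span, a subspace of $H$). Then there exists a finite wandering frame collection $X$ for $\pi$ that is complementary to $Y$. Moreover, $X$ may be chosen so that the closed linear spans of $\{\pi_g x : g\in G,\ x\in X\}$ and of $\{\pi_g y : g\in G,\ y\in Y\}$ are orthogonal.
   Context: A sequence $\{f_i\}_{i\in I}$ is a frame for a separable Hilbert space $K$ if there are constants $A,B>0$ with $A\|x\|^2 \le \sum_{i\in I}|\langle x,f_i\rangle|^2 \le B\|x\|^2$ for all $x\in K$. A finite collection of vectors $W=\{w_1,\dots,w_n\}\subset H$ is a wandering frame collection for $\pi$ if the family $\{\pi_g w_i : g\in G,\ i=1,\dots,n\}$ is a frame for its closed linear span; it is a complete wandering frame collection if this family is a frame for $H$. Two wandering frame collections $X=\{x_1,\dots,x_n\}$ and $Y=\{y_1,\dots,y_m\}$ for $\pi$ on $H$ are complementary if $X\cup Y$ is a complete wandering frame collection for $\pi$ on $H$ (the subspaces they generate are not required to be orthogonal). *)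

theory Defs
  imports "HOL-Analysis.Analysis" "HOL-Library.Countable"
begin

text \<open>
  Complex Hilbert spaces. The inner product is linear in the first argument; the last axiom says
  that the norm (complete by \<open>banach\<close>) is the one induced by the inner product, and it
  contains positive definiteness.
\<close>

class chilbert_space = banach +
  fixes scaleC :: "complex \<Rightarrow> 'a \<Rightarrow> 'a"  (infixr "*\<^sub>C" 75)
    and cinner :: "'a \<Rightarrow> 'a \<Rightarrow> complex"
  assumes scaleC_add_right: "c *\<^sub>C (x + y) = c *\<^sub>C x + c *\<^sub>C y"
    and scaleC_add_left: "(c + d) *\<^sub>C x = c *\<^sub>C x + d *\<^sub>C x"
    and scaleC_scaleC: "c *\<^sub>C d *\<^sub>C x = (c * d) *\<^sub>C x"
    and scaleC_of_real: "complex_of_real r *\<^sub>C x = r *\<^sub>R x"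
    and cinner_commute: "cinner x y = cnj (cinner y x)"
    and cinner_add_left: "cinner (x + y) z = cinner x z + cinner y z"
    and cinner_scaleC_left: "cinner (c *\<^sub>C x) y = c * cinner x y"
    and cinner_self: "cinner x x = complex_of_real ((norm x)\<^sup>2)"

instantiation complex :: chilbert_space
begin

definition scaleC_complex :: "complex \<Rightarrow> complex \<Rightarrow> complex"
  where "scaleC_complex c x = c * x"

definition cinner_complex :: "complex \<Rightarrow> complex \<Rightarrow> complex"
  where "cinner_complex x y = x * cnj y"

instance
  by standard
    (auto simp: scaleC_complex_def cinner_complex_def algebra_simps scaleR_conv_of_real
      complex_norm_square simp del: of_real_power)

end

global_interpretation complex_vector:
  vector_space "scaleC :: complex \<Rightarrow> 'a \<Rightarrow> 'a :: chilbert_space"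
  defines cspan = complex_vector.span
proof
  show "1 *\<^sub>C x = x" for x :: 'a
    using scaleC_of_real[of 1 x] by simp
qed (simp_all add: scaleC_add_right scaleC_add_left scaleC_scaleC)

definition closed_span :: "'h :: chilbert_space set \<Rightarrow> 'h set"
  where "closed_span S = closure (cspan S)"

text \<open>
  \<open>K\<close> is meant to be a closed subspace. A frame is an indexed family, so repeated vectors
  count with multiplicity. Summability is required explicitly because \<open>infsum\<close> is \<open>0\<close> for
  families that are not summable.
\<close>

definition frame_for :: "'i set \<Rightarrow> ('i \<Rightarrow> 'h :: chilbert_space) \<Rightarrow> 'h set \<Rightarrow> bool"
  where "frame_for I f K \<longleftrightarrow>
    (\<forall>i\<in>I. f i \<in> K) \<and>
    (\<exists>A>0. \<exists>B>0. \<forall>x\<in>K.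
      (\<lambda>i. (cmod (cinner x (f i)))\<^sup>2) summable_on I \<and>
      A * (norm x)\<^sup>2 \<le> (\<Sum>\<^sub>\<infinity>i\<in>I. (cmod (cinner x (f i)))\<^sup>2) \<and>
      (\<Sum>\<^sub>\<infinity>i\<in>I. (cmod (cinner x (f i)))\<^sup>2) \<le> B * (norm x)\<^sup>2)"

definition unitary_op :: "('h :: chilbert_space \<Rightarrow> 'h) \<Rightarrow> bool"
  where "unitary_op U \<longleftrightarrow>
    Vector_Spaces.linear scaleC scaleC U \<and> surj U \<and> (\<forall>x y. cinner (U x) (U y) = cinner x y)"

definition unitary_rep :: "('g :: ab_group_add \<Rightarrow> 'h :: chilbert_space \<Rightarrow> 'h) \<Rightarrow> bool"
  where "unitary_rep \<pi> \<longleftrightarrow>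
    (\<forall>g. unitary_op (\<pi> g)) \<and> (\<forall>g h. \<pi> (g + h) = \<pi> g \<circ> \<pi> h)"

text \<open>The closed linear span of all \<open>\<pi> g w\<close> with \<open>w \<in> W\<close>.\<close>

definition orbit_span :: "('g \<Rightarrow> 'h :: chilbert_space \<Rightarrow> 'h) \<Rightarrow> 'h set \<Rightarrow> 'h set"
  where "orbit_span \<pi> W = closed_span {\<pi> g w | g w. w \<in> W}"

text \<open>
  The family is indexed by pairs \<open>(g, w)\<close>: if \<open>\<pi> g w = \<pi> h w\<close> with \<open>g \<noteq> h\<close>, both
  indices contribute.
\<close>

definition wandering_frame_collection ::
    "('g \<Rightarrow> 'h :: chilbert_space \<Rightarrow> 'h) \<Rightarrow> 'h set \<Rightarrow> bool"
  where "wandering_frame_collection \<pi> W \<longleftrightarrow>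
    finite W \<and> frame_for (UNIV \<times> W) (\<lambda>(g, w). \<pi> g w) (orbit_span \<pi> W)"

definition complete_wandering_frame_collection ::
    "('g \<Rightarrow> 'h :: chilbert_space \<Rightarrow> 'h) \<Rightarrow> 'h set \<Rightarrow> bool"
  where "complete_wandering_frame_collection \<pi> W \<longleftrightarrow>
    finite W \<and> frame_for (UNIV \<times> W) (\<lambda>(g, w). \<pi> g w) UNIV"

definition complementary ::
    "('g \<Rightarrow> 'h :: chilbert_space \<Rightarrow> 'h) \<Rightarrow> 'h set \<Rightarrow> 'h set \<Rightarrow> bool"
  where "complementary \<pi> X Y \<longleftrightarrow>
    wandering_frame_collection \<pi> X \<and> wandering_frame_collection \<pi> Y \<and>
    complete_wandering_frame_collection \<pi> (X \<union> Y)"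

definition orthogonal_subspaces :: "'h :: chilbert_space set \<Rightarrow> 'h set \<Rightarrow> bool"
  where "orthogonal_subspaces K L \<longleftrightarrow> (\<forall>u\<in>K. \<forall>v\<in>L. cinner u v = 0)"

end

theory Submission imports Defs begin

text \<open>
  Let \<open>P\<close> be the orthogonal projection onto the orthogonal complement of \<open>orbit_span \<pi> Y\<close>. This
  complement is invariant, so \<open>P\<close> commutes with the representation and the coefficients of \<open>x\<close>
  against \<open>\<pi> g (P w)\<close> are those of \<open>P x\<close> against \<open>\<pi> g w\<close>. Hence \<open>X = P ` W\<close> inherits frame bounds
  on the complement, and by Pythagoras they combine with those of \<open>Y\<close> to bounds for \<open>X \<union> Y\<close>.
\<close>

section \<open>Algebra of the complex inner product and its norm\<close>

lemma cinner_add_right: "cinner x (y + z) = cinner x y + cinner x z"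
  for x y z :: "'h::chilbert_space"
  by (metis cinner_add_left cinner_commute complex_cnj_add)

lemma cinner_scaleC_right: "cinner x (c *\<^sub>C y) = cnj c * cinner x y"
  for x y :: "'h::chilbert_space"
  by (metis cinner_commute cinner_scaleC_left complex_cnj_mult)

lemma cinner_minus_left: "cinner (- x) y = - cinner x y" for x y :: "'h::chilbert_space"
  using cinner_scaleC_left[of "-1" x y] by simp

lemma cinner_minus_right: "cinner x (- y) = - cinner x y" for x y :: "'h::chilbert_space"
  by (metis cinner_commute cinner_minus_left complex_cnj_minus)

lemma cinner_diff_left: "cinner (x - y) z = cinner x z - cinner y z"
  for x y z :: "'h::chilbert_space"
  using cinner_add_left[of x "- y" z] by (simp add: cinner_minus_left)

lemma cinner_diff_right: "cinner x (y - z) = cinner x y - cinner x z"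
  for x y z :: "'h::chilbert_space"
  using cinner_add_right[of x y "- z"] by (simp add: cinner_minus_right)

lemma cinner_zero_left [simp]: "cinner 0 y = 0" for y :: "'h::chilbert_space"
  using cinner_diff_left[of 0 0 y] by simp

lemma cinner_zero_right [simp]: "cinner y 0 = 0" for y :: "'h::chilbert_space"
  using cinner_diff_right[of y 0 0] by simp

lemma cinner_zero_commute: "cinner x y = 0 \<longleftrightarrow> cinner y x = 0" for x y :: "'h::chilbert_space"
  by (metis cinner_commute complex_cnj_zero)

text \<open>The axioms give homogeneity of the norm for real scalars only; the complex case is read
  off from \<open>cinner_self\<close> after squaring.\<close>

lemma norm_scaleC: "norm (c *\<^sub>C x) = cmod c * norm x" for x :: "'h::chilbert_space"
proof -
  have "complex_of_real ((norm (c *\<^sub>C x))\<^sup>2) = (c * cnj c) * of_real ((norm x)\<^sup>2)"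
    unfolding cinner_self[symmetric] by (simp add: cinner_scaleC_left cinner_scaleC_right)
  also have "\<dots> = of_real ((cmod c * norm x)\<^sup>2)"
    by (simp add: complex_norm_square[symmetric] power_mult_distrib flip: of_real_power)
  finally show ?thesis
    by (simp only: of_real_eq_iff) (simp add: power2_eq_iff_nonneg)
qed

lemma norm_add_power2: "(norm (x + y))\<^sup>2 = (norm x)\<^sup>2 + (norm y)\<^sup>2 + 2 * Re (cinner x y)"
  for x y :: "'h::chilbert_space"
proof -
  have "complex_of_real ((norm (x + y))\<^sup>2)
      = of_real ((norm x)\<^sup>2) + of_real ((norm y)\<^sup>2) + (cinner x y + cnj (cinner x y))"
    unfolding cinner_self[symmetric]
    by (simp add: cinner_add_left cinner_add_right flip: cinner_commute)
  then show ?thesis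
    by (simp add: complex_add_cnj flip: of_real_add of_real_power del: of_real_mult of_real_power)
qed

lemma norm_diff_power2: "(norm (x - y))\<^sup>2 = (norm x)\<^sup>2 + (norm y)\<^sup>2 - 2 * Re (cinner x y)"
  for x y :: "'h::chilbert_space"
  using norm_add_power2[of x "- y"] by (simp add: cinner_minus_right)

lemma parallelogram_law:
  "(norm (x + y))\<^sup>2 + (norm (x - y))\<^sup>2 = 2 * (norm x)\<^sup>2 + 2 * (norm y)\<^sup>2"
  for x y :: "'h::chilbert_space"
  by (simp add: norm_add_power2 norm_diff_power2)

text \<open>Expresses the inner product through norms alone, so that its continuity reduces to that
  of the norm and of addition.\<close>

lemma cinner_polarization:
  "cinner x y = Complex (((norm (x + y))\<^sup>2 - (norm (x - y))\<^sup>2) / 4)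
    (((norm (x + \<i> *\<^sub>C y))\<^sup>2 - (norm (x - \<i> *\<^sub>C y))\<^sup>2) / 4)"
  for x y :: "'h::chilbert_space"
  by (simp add: norm_add_power2 norm_diff_power2 cinner_scaleC_right complex_eq_iff)

lemma continuous_on_cinner_left: "continuous_on S (\<lambda>x. cinner x y)"
  for y :: "'h::chilbert_space"
  unfolding cinner_polarization Complex_eq by (intro continuous_intros) auto

section \<open>Closed linear spans are closed subspaces\<close>

lemma continuous_on_scaleC: "continuous_on S (\<lambda>x :: 'h::chilbert_space. c *\<^sub>C x)"
proof (rule continuous_on_subset[OF linear_continuous_on[OF bounded_linear_intro] subset_UNIV])
  show "norm (c *\<^sub>C x) \<le> norm x * cmod c" for x :: 'h
    by (simp add: norm_scaleC)
  show "c *\<^sub>C (r *\<^sub>R x) = r *\<^sub>R (c *\<^sub>C x)" for r and x :: 'h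
    by (simp add: mult.commute flip: scaleC_of_real)
qed (simp add: scaleC_add_right)

text \<open>Asking for \<open>f x\<close> in \<open>closure S\<close> rather than in
  \<open>S\<close> makes this applicable when \<open>f\<close> adds a vector that lies only in the
  closure.\<close>

lemma closure_invariant:
  assumes "continuous_on UNIV f" "\<And>x. x \<in> S \<Longrightarrow> f x \<in> closure S" "x \<in> closure S"
  shows "f x \<in> closure S"
proof -
  have "f ` closure S \<subseteq> closure S"
    by (rule image_closure_subset[OF continuous_on_subset[OF assms(1) subset_UNIV] closed_closure])
      (use assms(2) in auto)
  then show ?thesis
    using assms(3) by auto
qed

text \<open>Each operation extends from the span by continuity. Addition is extended one summand at
  a time: first the second summand passes to the closure, then the first.\<close>

lemma subspace_closed_span: "complex_vector.subspace (closed_span S)"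
  unfolding complex_vector.subspace_def
proof (intro conjI ballI allI)
  show "0 \<in> closed_span S"
    unfolding closed_span_def using closure_subset complex_vector.span_zero by blast
  show "c *\<^sub>C x \<in> closed_span S" if "x \<in> closed_span S" for c x
    using that unfolding closed_span_def
    by (rule closure_invariant[OF continuous_on_scaleC, rotated])
      (meson closure_subset complex_vector.span_scale subsetD)
  fix x y assume xy: "x \<in> closed_span S" "y \<in> closed_span S"
  have *: "u + v \<in> closure (cspan S)" if "u \<in> cspan S" "v \<in> closure (cspan S)" for u v
    using that(2)
    by (rule closure_invariant[rotated 2])
      (use that(1) in \<open>auto intro!: continuous_intros subsetD[OF closure_subset]
        complex_vector.span_add\<close>)
  show "x + y \<in> closed_span S"
    using xy(1) unfolding closed_span_def
    by (rule closure_invariant[rotated 2])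
      (use * xy(2) in \<open>auto intro!: continuous_intros simp: closed_span_def\<close>)
qed

lemma closed_closed_span: "closed (closed_span S)"
  by (simp add: closed_span_def)

lemma closed_span_superset: "S \<subseteq> closed_span S"
  unfolding closed_span_def using closure_subset complex_vector.span_superset by blast

lemma closed_span_minimal:
  assumes "S \<subseteq> L" "complex_vector.subspace L" "closed L"
  shows "closed_span S \<subseteq> L"
  unfolding closed_span_def
  by (rule closure_minimal[OF complex_vector.span_minimal[OF assms(1,2)] assms(3)])

section \<open>Orthogonal complements and the projection theorem\<close>

definition orthocomplement :: "'h::chilbert_space set \<Rightarrow> 'h set"
  where "orthocomplement K = {x. \<forall>v\<in>K. cinner x v = 0}"

lemma subspace_orthocomplement: "complex_vector.subspace (orthocomplement K)"
  by (auto simp: complex_vector.subspace_def orthocomplement_def cinner_add_left cinner_scaleC_left)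

lemma closed_orthocomplement: "closed (orthocomplement K)"
proof -
  have "orthocomplement K = (\<Inter>v\<in>K. {x. cinner x v = 0})"
    by (auto simp: orthocomplement_def)
  then show ?thesis
    by (auto intro!: closed_Collect_eq continuous_on_cinner_left)
qed

text \<open>A sequence in \<open>K\<close> minimizing the distance to \<open>x\<close> is Cauchy by
  the parallelogram law. Its limit \<open>q\<close> is a nearest point of \<open>K\<close>, and
  minimality forces \<open>x - q\<close> to be orthogonal to \<open>K\<close>. The vector
  \<open>p\<close> obtained is the component \<open>x - q\<close> in the complement, not the one in
  \<open>K\<close>.\<close>

lemma orthogonal_decomposition:
  fixes x :: "'h::chilbert_space"
  assumes K: "complex_vector.subspace K" "closed K"
  obtains p where "p \<in> orthocomplement K" "x - p \<in> K"
proof -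
  define d where "d = (INF k\<in>K. (norm (x - k))\<^sup>2)"
  have bdd: "bdd_below ((\<lambda>k. (norm (x - k))\<^sup>2) ` K)"
    by (rule bdd_belowI2[of _ 0]) simp
  have ne: "K \<noteq> {}"
    using K(1) complex_vector.subspace_0 by blast
  have d_le: "d \<le> (norm (x - k))\<^sup>2" if "k \<in> K" for k
    unfolding d_def by (rule cINF_lower[OF bdd that])
  have "\<exists>k\<in>K. (norm (x - k))\<^sup>2 < d + 1 / Suc n" for n
    using cINF_less_iff[OF ne bdd, of "d + 1 / Suc n"] by (simp add: d_def)
  then obtain k where kK: "k n \<in> K" and k: "(norm (x - k n))\<^sup>2 < d + 1 / Suc n" for n
    by metis
  have dist_k: "(norm (k m - k n))\<^sup>2 \<le> 2 * (1 / Suc m) + 2 * (1 / Suc n)" for m n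
  proof -
    \<comment> \<open>The midpoint \<open>u\<close> stays in \<open>K\<close>, so its squared
      distance to \<open>x\<close> is at least \<open>d\<close>; the parallelogram law then leaves
      only the two errors \<open>1 / Suc m\<close> and \<open>1 / Suc n\<close>.\<close>
    define u where "u = (1 / 2) *\<^sub>R (k m + k n)"
    have "u \<in> K"
      unfolding u_def scaleC_of_real[symmetric]
      by (intro complex_vector.subspace_scale complex_vector.subspace_add K kK)
    have "(x - k m) + (x - k n) = 2 *\<^sub>R (x - u)"
      by (simp add: u_def algebra_simps scaleR_2)
    then have "4 * (norm (x - u))\<^sup>2 + (norm (k m - k n))\<^sup>2
        = 2 * (norm (x - k m))\<^sup>2 + 2 * (norm (x - k n))\<^sup>2"
      using parallelogram_law[of "x - k m" "x - k n"]
      by (simp add: power_mult_distrib norm_minus_commute)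
    then show ?thesis
      using d_le[OF \<open>u \<in> K\<close>] k[of m] k[of n] by linarith
  qed
  have "Cauchy k"
  proof (rule CauchyI)
    fix e :: real assume "e > 0"
    \<comment> \<open>The bound in \<open>dist_k\<close> is at most
      \<open>4 * inverse (Suc N)\<close>, whence the quarter of \<open>e\<^sup>2\<close>.\<close>
    then obtain N where N: "inverse (Suc N) < e\<^sup>2 / 4"
      using reals_Archimedean[of "e\<^sup>2 / 4"] by auto
    have "norm (k m - k n) < e" if "m \<ge> N" "n \<ge> N" for m n
    proof (rule power2_less_imp_less)
      have "1 / Suc m \<le> inverse (Suc N)" "1 / Suc n \<le> inverse (Suc N)"
        using that by (simp_all add: field_simps)
      then show "(norm (k m - k n))\<^sup>2 < e\<^sup>2"
        using dist_k[of m n] N by simp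
    qed (use \<open>e > 0\<close> in simp)
    then show "\<exists>N. \<forall>m\<ge>N. \<forall>n\<ge>N. norm (k m - k n) < e"
      by blast
  qed
  then obtain q where q: "k \<longlonglongrightarrow> q"
    using Cauchy_convergent convergent_def by blast
  have qK: "q \<in> K"
    using closed_sequentially[OF K(2)] kK q by blast
  have "(norm (x - q))\<^sup>2 \<le> d + 0"
  proof (rule LIMSEQ_le)
    show "(\<lambda>n. (norm (x - k n))\<^sup>2) \<longlonglongrightarrow> (norm (x - q))\<^sup>2"
      by (intro tendsto_intros q)
    show "(\<lambda>n. d + 1 / Suc n) \<longlonglongrightarrow> d + 0"
      by (intro tendsto_intros LIMSEQ_Suc[OF lim_1_over_n])
  qed (use k less_imp_le in blast)
  then have min: "(norm (x - q))\<^sup>2 \<le> (norm (x - v))\<^sup>2" if "v \<in> K" for v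
    using d_le[OF that] by linarith
  have "cinner (x - q) v = 0" if "v \<in> K" for v
  proof (cases "v = 0")
    case False
    define z where "z = x - q"
    \<comment> \<open>\<open>t *\<^sub>C v\<close> is the projection of \<open>z\<close> onto the
      line through \<open>v\<close>. Moving \<open>q\<close> by it would lower the squared distance
      by \<open>(cmod (cinner z v))\<^sup>2 / (norm v)\<^sup>2\<close>, so this quantity must
      vanish.\<close>
    define t where "t = cinner z v / (norm v)\<^sup>2"
    have "q + t *\<^sub>C v \<in> K"
      by (intro complex_vector.subspace_scale complex_vector.subspace_add K qK that)
    then have "(norm z)\<^sup>2 \<le> (norm (z - t *\<^sub>C v))\<^sup>2"
      using min by (simp add: z_def diff_diff_eq)
    moreover have "(norm (t *\<^sub>C v))\<^sup>2 = (cmod (cinner z v))\<^sup>2 / (norm v)\<^sup>2"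
      using False
      by (simp add: norm_scaleC t_def norm_divide power_mult_distrib power_divide
          norm_power norm_mult field_simps power2_eq_square)
    moreover have "cinner z (t *\<^sub>C v) = complex_of_real ((cmod (cinner z v))\<^sup>2 / (norm v)\<^sup>2)"
      by (simp add: cinner_scaleC_right t_def complex_norm_square mult.commute del: of_real_power)
    ultimately have "(cmod (cinner z v))\<^sup>2 / (norm v)\<^sup>2 \<le> 0"
      by (simp add: norm_diff_power2)
    then show ?thesis
      using False by (simp add: z_def divide_le_0_iff)
  qed simp
  then have "x - q \<in> orthocomplement K"
    by (simp add: orthocomplement_def)
  then show thesis
    using that qK by fastforce
qed

lemma orthocomplement_Int: "x \<in> K \<Longrightarrow> x \<in> orthocomplement K \<Longrightarrow> x = 0"
  using cinner_self[of x] by (auto simp: orthocomplement_def)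

section \<open>Infinite sums over a product with a finite second factor\<close>

text \<open>The product is a finite disjoint union of slices, each a copy of
  \<open>A\<close>.\<close>

lemma has_sum_Times_finite:
  fixes f :: "'a \<times> 'b \<Rightarrow> 'c::topological_comm_monoid_add"
  assumes "finite W" "\<And>w. w \<in> W \<Longrightarrow> ((\<lambda>g. f (g, w)) has_sum s w) A"
  shows "(f has_sum sum s W) (A \<times> W)"
proof -
  have "(f has_sum s w) ((\<lambda>g. (g, w)) ` A)" if "w \<in> W" for w
    using assms(2)[OF that] by (subst has_sum_reindex) (auto simp: o_def inj_on_def)
  then have "(f has_sum sum s W) (\<Union>w\<in>W. (\<lambda>g. (g, w)) ` A)"
    by (intro sum_has_sum assms(1)) auto
  also have "(\<Union>w\<in>W. (\<lambda>g. (g, w)) ` A) = A \<times> W"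
    by auto
  finally show ?thesis .
qed

lemma infsum_Times_finite:
  fixes f :: "'a \<times> 'b \<Rightarrow> 'c::{topological_comm_monoid_add, t2_space}"
  assumes "finite W" "\<And>w. w \<in> W \<Longrightarrow> (\<lambda>g. f (g, w)) summable_on A"
  shows "infsum f (A \<times> W) = (\<Sum>w\<in>W. infsum (\<lambda>g. f (g, w)) A)"
  using assms by (intro infsumI has_sum_Times_finite has_sum_infsum)

lemma summable_on_Times_finite:
  fixes f :: "'a \<times> 'b \<Rightarrow> 'c::banach"
  assumes "finite W"
  shows "f summable_on A \<times> W \<longleftrightarrow> (\<forall>w\<in>W. (\<lambda>g. f (g, w)) summable_on A)"
proof
  assume f: "f summable_on A \<times> W"
  show "\<forall>w\<in>W. (\<lambda>g. f (g, w)) summable_on A"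
  proof
    fix w assume "w \<in> W"
    then have "f summable_on (\<lambda>g. (g, w)) ` A"
      by (intro summable_on_subset_banach[OF f]) auto
    then show "(\<lambda>g. f (g, w)) summable_on A"
      by (subst (asm) summable_on_reindex) (auto simp: o_def inj_on_def)
  qed
next
  assume "\<forall>w\<in>W. (\<lambda>g. f (g, w)) summable_on A"
  then show "f summable_on A \<times> W"
    by (intro has_sum_imp_summable[OF has_sum_Times_finite[OF assms has_sum_infsum]]) auto
qed

section \<open>Frame conditions expressed orbit by orbit\<close>

definition orbit_energy :: "('g \<Rightarrow> 'h::chilbert_space \<Rightarrow> 'h) \<Rightarrow> 'h \<Rightarrow> 'h \<Rightarrow> real"
  where "orbit_energy \<pi> x w = (\<Sum>\<^sub>\<infinity>g. (cmod (cinner x (\<pi> g w)))\<^sup>2)"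

lemma orbit_energy_nonneg: "orbit_energy \<pi> x w \<ge> 0"
  unfolding orbit_energy_def by (rule infsum_nonneg) simp

text \<open>Splits the frame sum into one sum per orbit, so that later only finite sets of
  generators have to be compared. The two sums are identified under summability, hence the
  equivalence \<open>frame\<close> is proved for the whole conjunction.\<close>

lemma frame_for_orbits_iff:
  assumes "finite W"
  shows "frame_for (UNIV \<times> W) (\<lambda>(g, w). \<pi> g w) K \<longleftrightarrow>
    (\<forall>g. \<forall>w\<in>W. \<pi> g w \<in> K) \<and>
    (\<exists>A>0. \<exists>B>0. \<forall>x\<in>K.
      (\<forall>w\<in>W. (\<lambda>g. (cmod (cinner x (\<pi> g w)))\<^sup>2) summable_on UNIV) \<and>
      A * (norm x)\<^sup>2 \<le> (\<Sum>w\<in>W. orbit_energy \<pi> x w) \<and>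
      (\<Sum>w\<in>W. orbit_energy \<pi> x w) \<le> B * (norm x)\<^sup>2)"
proof -
  let ?f = "\<lambda>x i. (cmod (cinner x (case i of (g, w) \<Rightarrow> \<pi> g w)))\<^sup>2"
  let ?s = "\<lambda>x. \<forall>w\<in>W. (\<lambda>g. (cmod (cinner x (\<pi> g w)))\<^sup>2) summable_on UNIV"
  have s: "?f x summable_on UNIV \<times> W \<longleftrightarrow> ?s x" for x
    by (simp add: summable_on_Times_finite[OF assms])
  have "infsum (?f x) (UNIV \<times> W) = (\<Sum>w\<in>W. orbit_energy \<pi> x w)" if "?s x" for x
    using that by (simp add: infsum_Times_finite[OF assms] orbit_energy_def)
  then have frame: "(?f x summable_on UNIV \<times> W \<and> A * (norm x)\<^sup>2 \<le> infsum (?f x) (UNIV \<times> W) \<and>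
        infsum (?f x) (UNIV \<times> W) \<le> B * (norm x)\<^sup>2) \<longleftrightarrow>
      (?s x \<and> A * (norm x)\<^sup>2 \<le> (\<Sum>w\<in>W. orbit_energy \<pi> x w) \<and>
        (\<Sum>w\<in>W. orbit_energy \<pi> x w) \<le> B * (norm x)\<^sup>2)" for A B x
    unfolding s by auto
  then show ?thesis
    unfolding frame_for_def frame by simp
qed

section \<open>Unitary operators and invariant subspaces\<close>

lemma unitary_op_isometry:
  assumes "unitary_op U"
  shows "norm (U x) = norm x"
proof -
  have "complex_of_real ((norm (U x))\<^sup>2) = complex_of_real ((norm x)\<^sup>2)"
    using assms unfolding cinner_self[symmetric] by (simp add: unitary_op_def)
  then show ?thesis
    by (simp only: of_real_eq_iff) (simp add: power2_eq_iff_nonneg)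
qed

lemma unitary_op_add: "unitary_op U \<Longrightarrow> U (x + y) = U x + U y"
  and unitary_op_scaleC: "unitary_op U \<Longrightarrow> U (c *\<^sub>C x) = c *\<^sub>C U x"
  by (auto simp: unitary_op_def Vector_Spaces.linear_iff)

lemma continuous_on_unitary_op:
  assumes "unitary_op U"
  shows "continuous_on S U"
proof (rule linear_continuous_on[OF bounded_linear_intro])
  show "norm (U x) \<le> norm x * 1" for x
    by (simp add: unitary_op_isometry[OF assms])
  show "U (r *\<^sub>R x) = r *\<^sub>R U x" for r x
    by (simp add: unitary_op_scaleC[OF assms] flip: scaleC_of_real)
qed (rule unitary_op_add[OF assms])

text \<open>The preimage of \<open>closed_span S\<close> under \<open>U\<close> is a closed subspace
  containing \<open>S\<close>, hence contains \<open>closed_span S\<close>.\<close>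

lemma unitary_op_closed_span:
  assumes U: "unitary_op U" and "U ` S \<subseteq> closed_span S" "v \<in> closed_span S"
  shows "U v \<in> closed_span S"
proof -
  have "U 0 = 0"
    using unitary_op_add[OF U, of 0 0] by simp
  then have "complex_vector.subspace (U -` closed_span S)"
    using subspace_closed_span[of S]
    by (simp add: complex_vector.subspace_def unitary_op_add[OF U] unitary_op_scaleC[OF U])
  moreover have "closed (U -` closed_span S)"
    by (rule closed_vimage[OF closed_closed_span continuous_on_unitary_op[OF U]])
  ultimately have "closed_span S \<subseteq> U -` closed_span S"
    using assms(2) by (intro closed_span_minimal) auto
  then show ?thesis
    using assms(3) by auto
qed

lemma orbit_span_superset: "w \<in> W \<Longrightarrow> \<pi> g w \<in> orbit_span \<pi> W"
  unfolding orbit_span_def by (rule subsetD[OF closed_span_superset]) auto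

text \<open>Since \<open>\<pi> h (\<pi> g y) = \<pi> (h + g) y\<close>, the operator
  \<open>\<pi> h\<close> maps generators to generators.\<close>

lemma unitary_rep_orbit_span:
  assumes "unitary_rep \<pi>" "v \<in> orbit_span \<pi> Y"
  shows "\<pi> h v \<in> orbit_span \<pi> Y"
  unfolding orbit_span_def
proof (rule unitary_op_closed_span[of "\<pi> h"])
  have "\<pi> h (\<pi> g y) = \<pi> (h + g) y" for g y
    using assms(1) by (simp add: unitary_rep_def)
  then have "\<pi> h ` {\<pi> g y | g y. y \<in> Y} \<subseteq> {\<pi> g y | g y. y \<in> Y}"
    by auto
  then show "\<pi> h ` {\<pi> g y | g y. y \<in> Y} \<subseteq> closed_span {\<pi> g y | g y. y \<in> Y}"
    by (rule order_trans[OF _ closed_span_superset])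
qed (use assms in \<open>auto simp: unitary_rep_def orbit_span_def\<close>)

text \<open>The adjoint of \<open>\<pi> g\<close> is its inverse \<open>\<pi> (- g)\<close>.\<close>

lemma unitary_rep_cinner_minus:
  assumes "unitary_rep \<pi>"
  shows "cinner (\<pi> g x) v = cinner x (\<pi> (- g) v)"
proof -
  have unitary: "unitary_op (\<pi> h)" and comp: "\<pi> h (\<pi> k u) = \<pi> (h + k) u" for h k u
    using assms by (simp_all add: unitary_rep_def)
  \<comment> \<open>That \<open>\<pi> 0\<close> is the identity is not an axiom of
    \<open>unitary_rep\<close>; writing \<open>v\<close> as \<open>\<pi> 0 u\<close> by surjectivity
    lets the group law absorb the zero.\<close>
  obtain u where "v = \<pi> 0 u"
    using unitary[of 0] by (metis unitary_op_def surjD)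
  then have "\<pi> g (\<pi> (- g) v) = v"
    by (simp add: comp)
  then show ?thesis
    using unitary[of g] by (metis unitary_op_def)
qed

text \<open>Moving \<open>\<pi> g\<close> to the other argument turns it into
  \<open>\<pi> (- g)\<close>, which also preserves \<open>K\<close>.\<close>

lemma unitary_rep_orthocomplement:
  assumes "unitary_rep \<pi>" "\<And>g v. v \<in> K \<Longrightarrow> \<pi> g v \<in> K" "x \<in> orthocomplement K"
  shows "\<pi> g x \<in> orthocomplement K"
  using assms by (simp add: orthocomplement_def unitary_rep_cinner_minus)

theorem theorem2:
  fixes \<pi> :: "'g :: {ab_group_add, countable} \<Rightarrow> 'h :: chilbert_space \<Rightarrow> 'h"
    and W Y :: "'h set"
  assumes "unitary_rep \<pi>"
    and "complete_wandering_frame_collection \<pi> W"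
    and "wandering_frame_collection \<pi> Y"
  shows "\<exists>X. finite X \<and> wandering_frame_collection \<pi> X \<and> complementary \<pi> X Y \<and>
    orthogonal_subspaces (orbit_span \<pi> X) (orbit_span \<pi> Y)"
proof -

  \<comment> \<open>The projection \<open>P\<close> and its compatibility with the
    representation\<close>
  define K where "K = orbit_span \<pi> Y"
  define L where "L = orthocomplement K"
  have K: "complex_vector.subspace K" "closed K"
    unfolding K_def orbit_span_def by (rule subspace_closed_span closed_closed_span)+
  have \<pi>K: "\<pi> g v \<in> K" if "v \<in> K" for g v
    using unitary_rep_orbit_span[OF assms(1)] that by (simp add: K_def)
  have \<pi>L: "\<pi> g v \<in> L" if "v \<in> L" for g v
    using unitary_rep_orthocomplement[OF assms(1)] \<pi>K that by (simp add: L_def)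
  have "\<exists>p. p \<in> L \<and> x - p \<in> K" for x
    using orthogonal_decomposition[OF K] by (metis L_def)
  then obtain P where PL: "P x \<in> L" and PK: "x - P x \<in> K" for x
    by metis
  have orth: "cinner u v = 0" "cinner v u = 0" if "u \<in> L" "v \<in> K" for u v
    using that cinner_zero_commute by (auto simp: L_def orthocomplement_def)
  \<comment> \<open>\<open>P\<close> comes from a mere choice; here uniqueness of the decomposition
    is used: \<open>x - P x\<close> lies in both \<open>K\<close> and \<open>L\<close>.\<close>
  have P_id: "P x = x" if "x \<in> L" for x
  proof -
    have "x - P x \<in> L"
      unfolding L_def
      by (rule complex_vector.subspace_diff[OF subspace_orthocomplement])
        (use that PL in \<open>simp_all add: L_def\<close>)
    then show ?thesis
      using orthocomplement_Int[OF PK, of x] by (simp add: L_def)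
  qed
  have norm_P: "(norm x)\<^sup>2 = (norm (P x))\<^sup>2 + (norm (x - P x))\<^sup>2" for x
    using norm_add_power2[of "P x" "x - P x"] orth[OF PL PK] by simp
  have \<pi>_diff: "\<pi> g (x - y) = \<pi> g x - \<pi> g y" for g x y
    using unitary_op_add[of "\<pi> g" "x - y" y] assms(1) by (simp add: unitary_rep_def)
  \<comment> \<open>Both sides equal \<open>cinner (P x) (\<pi> g (P w))\<close>: the discarded
    terms pair a vector of \<open>K\<close> with one of \<open>L\<close>, as both subspaces are
    invariant.\<close>
  have cinner_P: "cinner x (\<pi> g (P w)) = cinner (P x) (\<pi> g w)" for x g w
  proof -
    have "cinner (x - P x) (\<pi> g (P w)) = 0" "cinner (P x) (\<pi> g (w - P w)) = 0"
      using orth PK PL \<pi>K \<pi>L by blast+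
    then show ?thesis
      by (simp add: \<pi>_diff cinner_diff_left cinner_diff_right)
  qed
  have Y_K: "\<pi> g y \<in> K" if "y \<in> Y" for g y
    using orbit_span_superset[OF that] by (simp add: K_def)
  have cinner_Y: "cinner x (\<pi> g y) = cinner (x - P x) (\<pi> g y)" if "y \<in> Y" for x g y
    using orth(1)[OF PL Y_K[OF that]] by (simp add: cinner_diff_left)

  let ?sum = "\<lambda>x w. (\<lambda>g. (cmod (cinner x (\<pi> g w)))\<^sup>2) summable_on UNIV"
  let ?E = "\<lambda>x Z. \<Sum>z\<in>Z. orbit_energy \<pi> x z"
  have "finite W"
    using assms(2) by (simp add: complete_wandering_frame_collection_def)
  then obtain A B where AB: "A > 0" "B > 0"
    and W: "\<And>x w. w \<in> W \<Longrightarrow> ?sum x w"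
      "\<And>x. A * (norm x)\<^sup>2 \<le> ?E x W" "\<And>x. ?E x W \<le> B * (norm x)\<^sup>2"
    using assms(2) by (auto simp: complete_wandering_frame_collection_def frame_for_orbits_iff)
  have "finite Y"
    using assms(3) by (simp add: wandering_frame_collection_def)
  \<comment> \<open>These bounds are available on \<open>K\<close> only; for a general
    \<open>x\<close> they are applied to its component \<open>x - P x\<close>.\<close>
  then obtain A' B' where AB': "A' > 0" "B' > 0"
    and Y: "\<And>x w. x \<in> K \<Longrightarrow> w \<in> Y \<Longrightarrow> ?sum x w"
      "\<And>x. x \<in> K \<Longrightarrow> A' * (norm x)\<^sup>2 \<le> ?E x Y" "\<And>x. x \<in> K \<Longrightarrow> ?E x Y \<le> B' * (norm x)\<^sup>2"
    using assms(3) by (auto simp: wandering_frame_collection_def frame_for_orbits_iff K_def)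

  \<comment> \<open>Frame bounds for the projected generators \<open>X\<close>\<close>
  define X where "X = P ` W"
  \<comment> \<open>The \<open>1 +\<close> keeps the denominator positive when \<open>W\<close> is
    empty.\<close>
  define C where "C = A / (1 + card W)"
  have "C > 0"
    using AB by (simp add: C_def add_pos_nonneg)
  have "finite X"
    using \<open>finite W\<close> by (simp add: X_def)
  have X_L: "\<pi> g v \<in> L" if "v \<in> X" for g v
    using that \<pi>L PL by (auto simp: X_def)
  have sum_X: "?sum x w" if "w \<in> X" for x w
    using that W(1)[of _ "P x"] by (auto simp: X_def cinner_P)
  have energy_P: "orbit_energy \<pi> x (P w) = orbit_energy \<pi> (P x) w" for x w
    by (simp add: orbit_energy_def cinner_P)
  have X_upper: "?E x X \<le> B * (norm (P x))\<^sup>2" for x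
  proof -
    \<comment> \<open>Vectors of \<open>W\<close> with the same image under \<open>P\<close> count
      once in \<open>X\<close>, so passing to the image can only decrease a sum of nonnegative
      terms.\<close>
    have "?E x X \<le> (\<Sum>w\<in>W. orbit_energy \<pi> x (P w))"
      unfolding X_def using sum_image_le[OF \<open>finite W\<close>, of "orbit_energy \<pi> x" P]
      by (simp add: orbit_energy_nonneg o_def)
    then show ?thesis
      using W(3)[of "P x"] by (simp add: energy_P)
  qed
  \<comment> \<open>\<open>P\<close> may identify up to \<open>card W\<close> elements of \<open>W\<close>, which costs a factor in the lower bound.\<close>
  have X_lower: "C * (norm (P x))\<^sup>2 \<le> ?E x X" for x
  proof -
    have "orbit_energy \<pi> (P x) w \<le> ?E x X" if "w \<in> W" for w
      unfolding energy_P[symmetric] using that \<open>finite X\<close>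
      by (intro member_le_sum) (auto simp: X_def orbit_energy_nonneg)
    then have "?E (P x) W \<le> card W * ?E x X"
      by (rule sum_bounded_above)
    also have "\<dots> \<le> (1 + card W) * ?E x X"
      by (intro mult_right_mono sum_nonneg orbit_energy_nonneg) simp
    finally have "A * (norm (P x))\<^sup>2 \<le> (1 + card W) * ?E x X"
      using W(2)[of "P x"] by linarith
    then show ?thesis
      by (simp add: C_def divide_le_eq add_pos_nonneg mult.commute)
  qed
  have energy_Y: "?E x Y = ?E (x - P x) Y" for x
    by (simp add: orbit_energy_def cinner_Y[of _ x])
  have sum_Y: "?sum x w" if "w \<in> Y" for x w
    using Y(1)[OF PK[of x] that] by (simp add: cinner_Y[OF that, of x])

  have X_span: "orbit_span \<pi> X \<subseteq> L"
    unfolding orbit_span_def L_def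
    by (rule closed_span_minimal)
      (use X_L in \<open>auto simp: L_def subspace_orthocomplement closed_orthocomplement\<close>)
  \<comment> \<open>\<open>P\<close> is the identity on \<open>L\<close>, so on the span of
    \<open>X\<close> the bounds in terms of \<open>P x\<close> become bounds in terms of
    \<open>x\<close>.\<close>
  have "C * (norm x)\<^sup>2 \<le> ?E x X \<and> ?E x X \<le> B * (norm x)\<^sup>2" if "x \<in> orbit_span \<pi> X" for x
    using X_lower[of x] X_upper[of x] that X_span P_id by auto
  then have wandering_X: "wandering_frame_collection \<pi> X"
    unfolding wandering_frame_collection_def frame_for_orbits_iff[OF \<open>finite X\<close>]
    using \<open>finite X\<close> sum_X \<open>C > 0\<close> AB(2) orbit_span_superset[of _ X \<pi>] by blast

  \<comment> \<open>A vector common to \<open>X\<close> and \<open>Y\<close> counts once in the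
    union. Each separate sum is therefore compared with the sum over \<open>X \<union> Y\<close>,
    and the factor 1/2 makes up for adding the two comparisons.\<close>
  define m where "m = min C A' / 2"
  have "m > 0"
    using \<open>C > 0\<close> AB' by (simp add: m_def)
  have m: "m * (norm x)\<^sup>2 \<le> ?E x (X \<union> Y)" for x
  proof -
    have "?E x X \<le> ?E x (X \<union> Y)" "?E x Y \<le> ?E x (X \<union> Y)"
      using \<open>finite X\<close> \<open>finite Y\<close> by (auto intro!: sum_mono2 orbit_energy_nonneg)
    moreover have "2 * m * (norm (P x))\<^sup>2 \<le> C * (norm (P x))\<^sup>2"
      "2 * m * (norm (x - P x))\<^sup>2 \<le> A' * (norm (x - P x))\<^sup>2"
      by (simp_all add: m_def mult_right_mono)
    ultimately show ?thesis
      using X_lower[of x] Y(2)[OF PK[of x]] norm_P[of x] energy_Y[of x]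
      by (simp add: algebra_simps)
  qed
  have BB': "?E x (X \<union> Y) \<le> (B + B') * (norm x)\<^sup>2" for x
  proof -
    \<comment> \<open>Inclusion-exclusion, where the sum over \<open>X \<inter> Y\<close> is
      nonnegative.\<close>
    have "?E x (X \<union> Y) \<le> ?E x X + ?E x Y"
      using sum.union_inter[OF \<open>finite X\<close> \<open>finite Y\<close>, of "orbit_energy \<pi> x"]
        sum_nonneg[of "X \<inter> Y" "orbit_energy \<pi> x"] by (simp add: orbit_energy_nonneg)
    also have "\<dots> \<le> B * (norm (P x))\<^sup>2 + B' * (norm (x - P x))\<^sup>2"
      using X_upper[of x] Y(3)[OF PK[of x]] energy_Y[of x] by simp
    \<comment> \<open>By Pythagoras neither component of \<open>x\<close> is longer than
      \<open>x\<close>.\<close>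
    also have "\<dots> \<le> B * (norm x)\<^sup>2 + B' * (norm x)\<^sup>2"
      using AB AB' norm_P[of x] by (intro add_mono mult_left_mono) auto
    finally show ?thesis
      by (simp add: algebra_simps)
  qed
  have "complete_wandering_frame_collection \<pi> (X \<union> Y)"
    unfolding complete_wandering_frame_collection_def
  proof (subst frame_for_orbits_iff, goal_cases)
    case 2
    have "B + B' > 0"
      using AB AB' by simp
    moreover have "\<forall>w\<in>X \<union> Y. ?sum x w" for x
      using sum_X sum_Y by auto
    ultimately show ?case
      using \<open>finite X\<close> \<open>finite Y\<close> \<open>m > 0\<close> m BB' by blast
  qed (use \<open>finite X\<close> \<open>finite Y\<close> in simp)
  moreover have "orthogonal_subspaces (orbit_span \<pi> X) (orbit_span \<pi> Y)"
    using orth(1) X_span by (auto simp: orthogonal_subspaces_def K_def)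
  ultimately show ?thesis
    using \<open>finite X\<close> wandering_X assms(3) by (auto simp: complementary_def)
qed

end
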